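(* Let $g$ be an arithmetic function with $g(1) = 1$. Let $s_{n,k} := [q^n]\, (q;q)_\infty \frac{q^k}{1-q^k}$ for $n,k \ge 1$, let $\widetilde{s}_{n,k}(g) := \sum_{j=1}^n s_{n,kj}\, g(j)$, and let $(s^{(-1)}_{n,k}(g))_{n,k\ge1}$ be the inverse of the lower-triangular matrix $(\widetilde{s}_{n,k}(g))_{n,k \geq 1}$. Then for all $n, k \geq 1$, \[ \sum_{d|n} s_{d,k}^{(-1)}(g) = p_k(n) + \sum_{j=1}^{\Omega(n)} (p_k \ast \mathrm{ds}_{2j,g})(n) = p_k(n) + (p_k \ast D_{g})(n), \] equivalently (by Möbius inversion) \[ s_{n,k}^{(-1)}(g) = (p_k \ast \mu)(n) + \sum_{j=1}^{\Omega(n)} (p_k \ast \mathrm{ds}_{2j,g} \ast \mu)(n) = (p_k \ast \mu)(n) + (p_k \ast D_{g} \ast \mu)(n). \]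
   Context: $(q;q)_\infty := \prod_{j\ge1}(1-q^j)$ and $[q^n]F(q)$ is the coefficient of $q^n$. Convention $s_{n,m}:=0$ for $m>n$. $(f\ast h)(n) := \sum_{d|n} f(d)h(n/d)$ is Dirichlet convolution, $\mu$ is the Möbius function, $\Omega(n)$ is the number of prime factors of $n$ counted with multiplicity. $p(m)$ is Euler's partition function with $p(m) := 0$ for $m<0$, and $p_k$ is the arithmetic function $p_k(n) := p(n-k)$. Define $g_{\pm}(n) := g(n)$ for $n>1$ and $g_{\pm}(1) := -1$, and recursively $\mathrm{ds}_{1,g}(n) := g_{\pm}(n)$, $\mathrm{ds}_{j,g}(n) := \sum_{d|n,\ d>1} g(d)\, \mathrm{ds}_{j-1,g}(n/d)$ for $j>1$. Finally $D_g(m) := \sum_{j=1}^{m} \mathrm{ds}_{2j,g}(m)$. *)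

theory Defs
  imports
    "HOL-Analysis.Analysis"
    "HOL-Computational_Algebra.Computational_Algebra"
begin

text \<open>
  Arithmetic functions have type \<open>nat \<Rightarrow> complex\<close>; their value at \<open>0\<close> is irrelevant. Infinite
  matrices have type \<open>nat \<Rightarrow> nat \<Rightarrow> complex\<close>, with rows and columns indexed from \<open>1\<close>.
\<close>

subsection \<open>Arithmetic functions\<close>

definition dirichlet_conv :: "(nat \<Rightarrow> complex) \<Rightarrow> (nat \<Rightarrow> complex) \<Rightarrow> nat \<Rightarrow> complex"
    (infixl \<open>\<star>\<close> 70) where
  "f \<star> h = (\<lambda>n. \<Sum>d | d dvd n. f d * h (n div d))"

definition mu :: "nat \<Rightarrow> complex" where
  "mu n = (if squarefree n then (-1) ^ card (prime_factors n) else 0)"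

definition big_omega :: "nat \<Rightarrow> nat" where
  "big_omega n = size (prime_factorization n)"

text \<open>A partition of \<open>m\<close> is a finite multiset of positive integers with sum \<open>m\<close>.\<close>

definition partition_count :: "int \<Rightarrow> nat" where
  "partition_count m = card {M :: nat multiset. 0 \<notin># M \<and> int (\<Sum>\<^sub># M) = m}"

definition p_shift :: "nat \<Rightarrow> nat \<Rightarrow> complex" where
  "p_shift k n = of_nat (partition_count (int n - int k))"

definition g_pm :: "(nat \<Rightarrow> complex) \<Rightarrow> nat \<Rightarrow> complex" where
  "g_pm g n = (if n = 1 then -1 else g n)"

text \<open>The index \<open>j\<close> starts at \<open>1\<close>; the value for \<open>j = 0\<close> is a dummy.\<close>

fun ds :: "(nat \<Rightarrow> complex) \<Rightarrow> nat \<Rightarrow> nat \<Rightarrow> complex" where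
  "ds g 0 n = 0"
| "ds g (Suc 0) n = g_pm g n"
| "ds g (Suc (Suc j)) n = (\<Sum>d | d dvd n \<and> d > 1. g d * ds g (Suc j) (n div d))"

definition D_fun :: "(nat \<Rightarrow> complex) \<Rightarrow> nat \<Rightarrow> complex" where
  "D_fun g m = (\<Sum>j = 1..m. ds g (2 * j) m)"

subsection \<open>The matrices\<close>

text \<open>
  The infinite product is taken in the topology of the formal power series ring, i.e. its partial
  products converge coefficientwise.
\<close>

definition q_poch :: "complex fps" where
  "q_poch = (\<Prod>j. 1 - fps_X ^ (j + 1))"

definition s_coeff :: "nat \<Rightarrow> nat \<Rightarrow> complex" where
  "s_coeff n k = fps_nth (q_poch * (fps_X ^ k / (1 - fps_X ^ k))) n"

definition s_tilde :: "(nat \<Rightarrow> complex) \<Rightarrow> nat \<Rightarrow> nat \<Rightarrow> complex" where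
  "s_tilde g n k = (\<Sum>j = 1..n. s_coeff n (k * j) * g j)"

definition lower_triangular :: "(nat \<Rightarrow> nat \<Rightarrow> complex) \<Rightarrow> bool" where
  "lower_triangular A \<longleftrightarrow> (\<forall>n\<ge>1. \<forall>k>n. A n k = 0)"

text \<open>
  Two-sided inverses among lower-triangular matrices. The sums over \<open>j\<close> in the matrix products
  stop at \<open>n\<close> because the \<open>n\<close>-th row of a lower-triangular matrix vanishes beyond that point.
  Entries outside of the index range are set to \<open>0\<close> to make the inverse unique as a function.
\<close>

definition is_lt_inverse ::
    "(nat \<Rightarrow> nat \<Rightarrow> complex) \<Rightarrow> (nat \<Rightarrow> nat \<Rightarrow> complex) \<Rightarrow> bool" where
  "is_lt_inverse A B \<longleftrightarrow>
     lower_triangular A \<and> lower_triangular B \<and> (\<forall>n k. n = 0 \<or> k = 0 \<longrightarrow> B n k = 0) \<and>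
     (\<forall>n\<ge>1. \<forall>k\<ge>1. (\<Sum>j = 1..n. A n j * B j k) = (if n = k then 1 else 0) \<and>
                   (\<Sum>j = 1..n. B n j * A j k) = (if n = k then 1 else 0))"

definition lt_inverse :: "(nat \<Rightarrow> nat \<Rightarrow> complex) \<Rightarrow> nat \<Rightarrow> nat \<Rightarrow> complex" where
  "lt_inverse A = (THE B. is_lt_inverse A B)"

definition s_inv :: "(nat \<Rightarrow> complex) \<Rightarrow> nat \<Rightarrow> nat \<Rightarrow> complex" where
  "s_inv g = lt_inverse (s_tilde g)"

subsection \<open>Well-definedness\<close>

lemma finite_partitions: "finite {M :: nat multiset. 0 \<notin># M \<and> int (\<Sum>\<^sub># M) = m}"
proof -
  have size_le: "size M \<le> \<Sum>\<^sub># M" if "0 \<notin># M" for M :: "nat multiset"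
    using that by (induction M) auto
  have "{M :: nat multiset. 0 \<notin># M \<and> int (\<Sum>\<^sub># M) = m} \<subseteq>
        mset ` {xs. set xs \<subseteq> {..nat m} \<and> length xs \<le> nat m}"
  proof
    fix M :: "nat multiset"
    assume "M \<in> {M. 0 \<notin># M \<and> int (\<Sum>\<^sub># M) = m}"
    hence M: "0 \<notin># M" "\<Sum>\<^sub># M = nat m"
      by (metis (mono_tags, lifting) mem_Collect_eq nat_int)+
    obtain xs where xs: "M = mset xs" by (metis ex_mset)
    have "x \<le> nat m" if "x \<in> set xs" for x
      using M(2) member_le_sum_list[OF that] by (simp add: xs sum_mset_sum_list)
    moreover have "length xs \<le> nat m"
      using size_le[OF M(1)] M(2) xs by simp
    ultimately show "M \<in> mset ` {xs. set xs \<subseteq> {..nat m} \<and> length xs \<le> nat m}"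
      using xs by auto
  qed
  thus ?thesis
    by (rule finite_subset) (intro finite_imageI finite_lists_length_le finite_atMost)
qed

lemma q_poch_nth:
  assumes "n \<le> N"
  shows "fps_nth q_poch n = fps_nth (\<Prod>j\<le>N. 1 - fps_X ^ (j + 1)) n"
    and "(\<lambda>j. 1 - fps_X ^ (j + 1) :: complex fps) has_prod q_poch"
proof -
  define f where "f = (\<lambda>j. 1 - fps_X ^ (j + 1) :: complex fps)"
  define P where "P = Abs_fps (\<lambda>n. fps_nth (prod f {..n}) n)"
  have prod_Suc: "fps_nth (prod f {..Suc N}) n = fps_nth (prod f {..N}) n" if "n \<le> N" for n N
  proof -
    have "prod f {..Suc N} = prod f {..N} - fps_X ^ (Suc N + 1) * prod f {..N}"
      by (simp add: f_def algebra_simps)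
    thus ?thesis using that by (simp add: fps_X_power_mult_nth del: power_Suc)
  qed
  have stable: "fps_nth (prod f {..N}) n = fps_nth P n" if "n \<le> N" for n N
    using that
  proof (induction N rule: dec_induct)
    case base
    show ?case by (simp add: P_def)
  next
    case (step m)
    thus ?case using prod_Suc[of n m] by simp
  qed
  have lim: "(\<lambda>N. prod f {..N}) \<longlonglongrightarrow> P"
    by (intro tendsto_fpsI eventually_sequentiallyI) (rule stable)
  have "fps_nth P 0 = 1" by (simp add: P_def f_def)
  hence "P \<noteq> 0" by force
  with lim have hp: "f has_prod P" by (simp add: has_prod_def raw_has_prod_def)
  hence eq: "q_poch = P" unfolding q_poch_def f_def by (metis has_prod_unique)
  show "fps_nth q_poch n = fps_nth (\<Prod>j\<le>N. 1 - fps_X ^ (j + 1)) n"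
    using stable[OF assms] by (simp add: eq f_def)
  show "(\<lambda>j. 1 - fps_X ^ (j + 1) :: complex fps) has_prod q_poch"
    using hp by (simp add: eq f_def)
qed

lemma s_coeff_altdef:
  assumes "k \<ge> 1"
  shows "s_coeff n k =
           (if n < k then 0 else fps_nth (q_poch * inverse (1 - fps_X ^ k)) (n - k))"
proof -
  have "fps_nth (1 - fps_X ^ k :: complex fps) 0 \<noteq> 0" using assms by simp
  hence "fps_X ^ k / (1 - fps_X ^ k :: complex fps) = fps_X ^ k * inverse (1 - fps_X ^ k)"
    by (rule fps_divide_unit)
  hence "q_poch * (fps_X ^ k / (1 - fps_X ^ k)) =
         fps_X ^ k * (q_poch * inverse (1 - fps_X ^ k))"
    by (simp only: mult_ac)
  thus ?thesis by (simp only: s_coeff_def fps_X_power_mult_nth)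
qed

lemma s_coeff_eq_0: "n < k \<Longrightarrow> s_coeff n k = 0"
  by (simp add: s_coeff_altdef)

lemma s_coeff_diag: "n \<ge> 1 \<Longrightarrow> s_coeff n n = 1"
  using q_poch_nth(1)[of 0 0] by (simp add: s_coeff_altdef)

lemma lower_triangular_s_tilde: "lower_triangular (s_tilde g)"
  unfolding lower_triangular_def s_tilde_def
proof (intro allI impI sum.neutral ballI)
  fix n k j :: nat assume "n < k" "j \<in> {1..n}"
  hence "n < k * j" by (metis atLeastAtMost_iff less_le_trans mult.right_neutral mult_le_mono2)
  thus "s_coeff n (k * j) * g j = 0" by (simp add: s_coeff_eq_0)
qed

lemma s_tilde_diag:
  assumes "n \<ge> 1"
  shows "s_tilde g n n = g 1"
proof -
  have "s_tilde g n n = (\<Sum>j\<in>{1}. s_coeff n (n * j) * g j)"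
    unfolding s_tilde_def
  proof (intro sum.mono_neutral_right ballI)
    fix j assume "j \<in> {1..n} - {1}"
    hence "n < n * j" using assms by auto
    thus "s_coeff n (n * j) * g j = 0" by (simp add: s_coeff_eq_0)
  qed (use assms in auto)
  thus ?thesis using assms by (simp add: s_coeff_diag)
qed

lemma lt_mult_assoc:
  assumes "lower_triangular Y"
  shows "(\<Sum>j = 1..n. X n j * (\<Sum>i = 1..j. Y j i * Z i k)) =
         (\<Sum>i = 1..n. (\<Sum>j = 1..n. X n j * Y j i) * Z i k)"
proof -
  have "(\<Sum>j = 1..n. X n j * (\<Sum>i = 1..j. Y j i * Z i k)) =
        (\<Sum>j = 1..n. X n j * (\<Sum>i = 1..n. Y j i * Z i k))"
    by (intro sum.cong refl arg_cong2[of _ _ _ _ "(*)"] sum.mono_neutral_left)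
       (use assms in \<open>auto simp: lower_triangular_def\<close>)
  also have "\<dots> = (\<Sum>j = 1..n. \<Sum>i = 1..n. X n j * Y j i * Z i k)"
    by (simp add: sum_distrib_left mult.assoc)
  also have "\<dots> = (\<Sum>i = 1..n. \<Sum>j = 1..n. X n j * Y j i * Z i k)"
    by (rule sum.swap)
  finally show ?thesis by (simp add: sum_distrib_right)
qed

lemma lt_inverses_eq:
  assumes "lower_triangular Y"
  assumes XY: "\<And>n k. n \<ge> 1 \<Longrightarrow> k \<ge> 1 \<Longrightarrow> (\<Sum>j = 1..n. X n j * Y j k) = (if n = k then 1 else 0)"
  assumes YZ: "\<And>n k. n \<ge> 1 \<Longrightarrow> k \<ge> 1 \<Longrightarrow> (\<Sum>j = 1..n. Y n j * Z j k) = (if n = k then 1 else 0)"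
  assumes X: "lower_triangular X" and nk: "n \<ge> 1" "k \<ge> 1"
  shows "X n k = Z n k"
proof -
  have "X n k = (\<Sum>j = 1..n. X n j * (if j = k then 1 else 0))"
    using X nk by (auto simp: lower_triangular_def if_distrib cong: if_cong)
  also have "\<dots> = (\<Sum>j = 1..n. X n j * (\<Sum>i = 1..j. Y j i * Z i k))"
    by (intro sum.cong refl) (use nk YZ in auto)
  also have "\<dots> = (\<Sum>i = 1..n. (if n = i then 1 else 0) * Z i k)"
    unfolding lt_mult_assoc[OF assms(1)] by (intro sum.cong refl) (use nk XY in auto)
  also have "\<dots> = Z n k"
    using nk by (auto simp: if_distrib[of "\<lambda>x. x * _"] cong: if_cong)
  finally show ?thesis .
qed

lemma is_lt_inverse_unique:
  assumes "is_lt_inverse A B" "is_lt_inverse A B'"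
  shows "B = B'"
proof (intro ext)
  fix n k
  show "B n k = B' n k"
  proof (cases "n = 0 \<or> k = 0")
    case True
    thus ?thesis using assms unfolding is_lt_inverse_def by metis
  next
    case False
    show ?thesis
      by (rule lt_inverses_eq[of A]) (use assms False in \<open>auto simp: is_lt_inverse_def\<close>)
  qed
qed

function forward_subst :: "(nat \<Rightarrow> nat \<Rightarrow> complex) \<Rightarrow> nat \<Rightarrow> nat \<Rightarrow> complex" where
  "forward_subst A n k =
     (if 1 \<le> k \<and> k \<le> n
      then ((if n = k then 1 else 0) - (\<Sum>j\<in>{k..<n}. A n j * forward_subst A j k)) / A n n
      else 0)"
  by auto
termination by (relation "Wellfounded.measure (\<lambda>(A, n, k). n)") auto

declare forward_subst.simps [simp del]

lemma forward_subst_eq_0: "n = 0 \<or> k = 0 \<or> n < k \<Longrightarrow> forward_subst A n k = 0"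
  by (subst forward_subst.simps) auto

lemma lower_triangular_forward_subst: "lower_triangular (forward_subst A)"
  by (simp add: lower_triangular_def forward_subst_eq_0)

lemma forward_subst_right_inverse:
  assumes "A n n \<noteq> 0" "n \<ge> 1" "k \<ge> 1"
  shows "(\<Sum>j = 1..n. A n j * forward_subst A j k) = (if n = k then 1 else 0)"
proof (cases "k \<le> n")
  case True
  have "(\<Sum>j = 1..n. A n j * forward_subst A j k) = (\<Sum>j\<in>{k..n}. A n j * forward_subst A j k)"
    by (rule sum.mono_neutral_right) (use assms in \<open>auto simp: forward_subst_eq_0\<close>)
  also have "{k..n} = insert n {k..<n}" using True by auto
  also have "(\<Sum>j\<in>\<dots>. A n j * forward_subst A j k) =
               A n n * forward_subst A n k + (\<Sum>j\<in>{k..<n}. A n j * forward_subst A j k)"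
    by simp
  also have "\<dots> = (if n = k then 1 else 0)"
    by (subst forward_subst.simps) (use assms True in simp)
  finally show ?thesis .
qed (auto simp: forward_subst_eq_0)

lemma is_lt_inverse_forward_subst:
  assumes A: "lower_triangular A" and diag: "\<And>n. n \<ge> 1 \<Longrightarrow> A n n \<noteq> 0"
  shows "is_lt_inverse A (forward_subst A)"
proof -
  define B where "B = forward_subst A"
  define C where "C = forward_subst B"
  have B: "lower_triangular B"
    by (simp add: B_def lower_triangular_forward_subst)
  have "B n n \<noteq> 0" if "n \<ge> 1" for n
    unfolding B_def by (subst forward_subst.simps) (use that diag in simp)
  hence BC: "(\<Sum>j = 1..n. B n j * C j k) = (if n = k then 1 else 0)" if "n \<ge> 1" "k \<ge> 1" for n k
    using that forward_subst_right_inverse unfolding C_def by blast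
  have AB: "(\<Sum>j = 1..n. A n j * B j k) = (if n = k then 1 else 0)" if "n \<ge> 1" "k \<ge> 1" for n k
    using that diag forward_subst_right_inverse unfolding B_def by blast
  have "A n k = C n k" if "n \<ge> 1" "k \<ge> 1" for n k
    by (rule lt_inverses_eq[OF B AB BC A that])
  hence BA: "(\<Sum>j = 1..n. B n j * A j k) = (if n = k then 1 else 0)" if "n \<ge> 1" "k \<ge> 1" for n k
    using BC[OF that] that by simp
  show ?thesis
    using A B AB BA unfolding is_lt_inverse_def B_def by (auto simp: forward_subst_eq_0)
qed

lemma is_lt_inverse_s_inv:
  assumes "g 1 = 1"
  shows "is_lt_inverse (s_tilde g) (s_inv g)"
  unfolding s_inv_def lt_inverse_def
proof (rule theI[of "is_lt_inverse (s_tilde g)"])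
  show inv: "is_lt_inverse (s_tilde g) (forward_subst (s_tilde g))"
    by (rule is_lt_inverse_forward_subst[OF lower_triangular_s_tilde])
       (use assms in \<open>simp add: s_tilde_diag\<close>)
  fix B assume "is_lt_inverse (s_tilde g) B"
  thus "B = forward_subst (s_tilde g)"
    using inv by (rule is_lt_inverse_unique)
qed

end

theory Submission
  imports Defs
begin

text \<open>
  Expanding the Lambert series factors the matrix \<open>s_tilde g\<close> as \<open>C G\<close>, where \<open>C n m\<close> is the coefficient
  of \<open>q\<close> to the power \<open>n - m\<close> in \<open>q_poch\<close> and \<open>G\<close> is Dirichlet convolution with \<open>g \<star> 1\<close>. The inverse of \<open>C\<close> has
  the columns \<open>p_shift k\<close>, by Euler's product for the partition function, and \<open>G\<close> is inverted by
  convolving with \<open>\<mu>\<close> and the Dirichlet inverse of \<open>g\<close>. The latter is the unit plus \<open>D_fun g\<close>, by the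
  alternating geometric series for \<open>(\<epsilon> + (g - \<epsilon>))\<^sup>-\<^sup>1\<close> with consecutive terms paired.
\<close>

section \<open>Dirichlet convolution\<close>

definition dirichlet_unit :: "nat \<Rightarrow> complex" where
  "dirichlet_unit n = (if n = 1 then 1 else 0)"

text \<open>All numbers divide \<open>0\<close>, and a sum over an infinite set defaults to
  \<open>0\<close>. This lets commutativity and associativity hold as equations between
  functions.\<close>

lemma dirichlet_conv_0 [simp]: "(f \<star> h) 0 = 0"
  by (simp add: dirichlet_conv_def)

lemma dirichlet_conv_cong:
  assumes "\<And>d. d dvd n \<Longrightarrow> n > 0 \<Longrightarrow> f d = f' d" "\<And>d. d dvd n \<Longrightarrow> n > 0 \<Longrightarrow> h d = h' d"
  shows "(f \<star> h) n = (f' \<star> h') n"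
proof (cases "n = 0")
  case False
  show ?thesis unfolding dirichlet_conv_def
  proof (intro sum.cong refl)
    fix d assume "d \<in> {d. d dvd n}"
    then have "d dvd n" "n div d dvd n" by (auto simp: div_dvd_iff_mult)
    then show "f d * h (n div d) = f' d * h' (n div d)" using assms False by simp
  qed
qed simp

lemma finite_factor_pairs: "(n::nat) > 0 \<Longrightarrow> finite {(a, b). a * b = n}"
  by (rule finite_subset[of _ "{..n} \<times> {..n}"]) (auto simp: dvd_imp_le)

text \<open>In this symmetric form the ring laws become reindexings of sums over
  factorizations.\<close>

lemma dirichlet_conv_factor_pairs:
  assumes "n > 0"
  shows "(f \<star> h) n = (\<Sum>(a, b) | a * b = n. f a * h b)"
  unfolding dirichlet_conv_def
  by (rule sum.reindex_bij_witness[of _ fst "\<lambda>d. (d, n div d)"]) (use assms in auto)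

lemma dirichlet_conv_commute: "f \<star> h = h \<star> f"
proof
  fix n show "(f \<star> h) n = (h \<star> f) n"
  proof (cases "n = 0")
    case False
    have "(\<Sum>(a, b) | a * b = n. f a * h b) = (\<Sum>(a, b) | a * b = n. h a * f b)"
      by (rule sum.reindex_bij_witness[of _ prod.swap prod.swap]) (auto simp: mult.commute)
    then show ?thesis using False by (simp add: dirichlet_conv_factor_pairs)
  qed simp
qed

lemma dirichlet_conv_assoc: "f \<star> h \<star> l = f \<star> (h \<star> l)"
proof
  fix n show "(f \<star> h \<star> l) n = (f \<star> (h \<star> l)) n"
  proof (cases "n = 0")
    case False
    define P where "P = (\<lambda>n::nat. {(a, b). a * b = n})"
    have fin: "finite (P m)" if "m > 0" for m
      using finite_factor_pairs[OF that] by (simp add: P_def)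
    have conv: "(f \<star> h) m = (\<Sum>x\<in>P m. f (fst x) * h (snd x))" if "m > 0" for f h m
      using that by (simp add: dirichlet_conv_factor_pairs P_def case_prod_beta)
    have pos: "fst x > 0" "snd x > 0" if "x \<in> P n" for x
      using that False by (auto simp: P_def)
    have "(f \<star> h \<star> l) n = (\<Sum>x\<in>P n. \<Sum>y\<in>P (fst x). f (fst y) * h (snd y) * l (snd x))"
      using False pos by (simp add: conv sum_distrib_right)
    also have "\<dots> = (\<Sum>(x, y)\<in>Sigma (P n) (\<lambda>x. P (fst x)). f (fst y) * h (snd y) * l (snd x))"
      using False pos fin by (intro sum.Sigma) auto
    \<comment> \<open>Both index sets describe the factorizations of \<open>n\<close> into three
      ordered factors; the witnesses only move the bracket.\<close>
    also have "\<dots> = (\<Sum>(x, y)\<in>Sigma (P n) (\<lambda>x. P (snd x)). f (fst x) * (h (fst y) * l (snd y)))"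
      by (rule sum.reindex_bij_witness[of _ "\<lambda>((a, b), (c, d)). ((a * c, d), (a, c))"
            "\<lambda>((a, b), (c, d)). ((c, d * b), (d, b))"]) (auto simp: P_def mult_ac)
    also have "\<dots> = (\<Sum>x\<in>P n. \<Sum>y\<in>P (snd x). f (fst x) * (h (fst y) * l (snd y)))"
      using False pos fin by (intro sum.Sigma[symmetric]) auto
    also have "\<dots> = (f \<star> (h \<star> l)) n"
      using False pos by (simp add: conv sum_distrib_left)
    finally show ?thesis .
  qed simp
qed

lemma dirichlet_conv_unit_right:
  assumes "n > 0"
  shows "(f \<star> dirichlet_unit) n = f n"
proof -
  have "(f \<star> dirichlet_unit) n = (\<Sum>d\<in>{n}. f d * dirichlet_unit (n div d))"
    unfolding dirichlet_conv_def
    by (rule sum.mono_neutral_right)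
       (use assms in \<open>auto simp: dirichlet_unit_def elim: dvdE\<close>)
  then show ?thesis using assms by (simp add: dirichlet_unit_def)
qed

lemma dirichlet_conv_add_right: "(f \<star> (\<lambda>n. h n + l n)) n = (f \<star> h) n + (f \<star> l) n"
  by (simp add: dirichlet_conv_def algebra_simps sum.distrib)

lemma dirichlet_conv_sum_right:
  "(f \<star> (\<lambda>n. \<Sum>j\<in>A. h j n)) n = (\<Sum>j\<in>A. (f \<star> h j) n)"
  unfolding dirichlet_conv_def by (simp add: sum_distrib_left sum.swap[of _ A])

lemma dirichlet_conv_one_right: "(f \<star> (\<lambda>_. 1)) n = (\<Sum>d | d dvd n. f d)"
  by (simp add: dirichlet_conv_def)

section \<open>The Moebius function\<close>

lemma squarefree_prime_mult:
  assumes "prime (p::nat)" "\<not> p dvd d"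
  shows "squarefree (p * d) \<longleftrightarrow> squarefree d"
proof -
  have "coprime p d" using assms by (simp add: prime_imp_coprime)
  then show ?thesis using assms(1)
    by (auto simp: squarefree_mult_coprime squarefree_prime dest: squarefree_multD)
qed

lemma mu_prime_mult:
  assumes "prime p" "\<not> p dvd d"
  shows "mu (p * d) = - mu d"
proof -
  have "d \<noteq> 0" using assms(2) by (metis dvd_0_right)
  have "p \<noteq> 0" using assms by auto
  have "prime_factors (p * d) = insert p (prime_factors d)"
    using assms \<open>d \<noteq> 0\<close> \<open>p \<noteq> 0\<close> by (simp add: prime_factors_product prime_prime_factors)
  moreover have "p \<notin> prime_factors d" using assms by auto
  ultimately show ?thesis
    using assms by (simp add: mu_def squarefree_prime_mult)
qed

text \<open>For a prime \<open>p\<close> dividing \<open>n\<close>, multiplication by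
  \<open>p\<close> pairs the squarefree divisors prime to \<open>p\<close> with those divisible by
  \<open>p\<close>. It flips the sign of \<open>mu\<close>, so everything cancels.\<close>

lemma mu_conv_one:
  assumes "n > 0"
  shows "(mu \<star> (\<lambda>_. 1)) n = dirichlet_unit n"
proof (cases "n = 1")
  case True
  then show ?thesis by (simp add: dirichlet_conv_def dirichlet_unit_def mu_def)
next
  case False
  obtain p where p: "prime p" "p dvd n" using False prime_factor_nat by blast
  define A where "A = {d. d dvd n \<and> \<not> p dvd d}"
  define B where "B = {d. d dvd n \<and> squarefree d \<and> p dvd d}"
  have fin: "finite {d. d dvd n}" using assms by simp
  have A: "A \<subseteq> {d. d dvd n}" by (auto simp: A_def)
  \<comment> \<open>Only divisors that are not squarefree are dropped, and there \<open>mu\<close>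
    vanishes.\<close>
  have "(\<Sum>d\<in>{d. d dvd n} - A. mu d) = (\<Sum>d\<in>B. mu d)"
    by (rule sum.mono_neutral_right) (use fin in \<open>auto simp: A_def B_def mu_def\<close>)
  also have "\<dots> = (\<Sum>d\<in>{d \<in> A. squarefree d}. - mu d)"
  proof (rule sum.reindex_bij_witness[of _ "\<lambda>d. p * d" "\<lambda>d. d div p"])
    fix d assume "d \<in> B"
    then obtain e where e: "d = p * e" "p * e dvd n" "squarefree (p * e)"
      by (auto simp: B_def)
    have "\<not> p dvd e"
    proof
      assume "p dvd e"
      then have "p\<^sup>2 dvd p * e" by (simp add: power2_eq_square)
      with e(3) p(1) show False by (auto simp: squarefree_def)
    qed
    with e p show "d div p \<in> {d \<in> A. squarefree d}" "p * (d div p) = d"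
      "- mu (d div p) = mu d"
      by (auto simp: A_def squarefree_prime_mult mu_prime_mult dest: dvd_mult_right)
  next
    fix d assume d: "d \<in> {d \<in> A. squarefree d}"
    then have "coprime p d" using p by (simp add: A_def prime_imp_coprime)
    with d p show "p * d div p = d" "p * d \<in> B"
      by (auto simp: A_def B_def squarefree_prime_mult divides_mult)
  qed
  also have "\<dots> = (\<Sum>d\<in>A. - mu d)"
    by (rule sum.mono_neutral_left) (use fin A in \<open>auto simp: mu_def intro: finite_subset\<close>)
  finally have "(\<Sum>d\<in>{d. d dvd n} - A. mu d) = (\<Sum>d\<in>A. - mu d)" .
  moreover have "(\<Sum>d | d dvd n. mu d) = (\<Sum>d\<in>{d. d dvd n} - A. mu d) + (\<Sum>d\<in>A. mu d)"
    by (rule sum.subset_diff[OF A fin])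
  ultimately show ?thesis
    using False by (simp add: dirichlet_conv_one_right dirichlet_unit_def sum_negf)
qed

section \<open>The Dirichlet inverse as an alternating series\<close>

lemma big_omega_mult: "a > 0 \<Longrightarrow> b > 0 \<Longrightarrow> big_omega (a * b) = big_omega a + big_omega b"
  by (simp add: big_omega_def prime_factorization_mult)

lemma big_omega_pos: "d > 1 \<Longrightarrow> big_omega d > 0"
  by (auto simp: big_omega_def prime_factorization_empty_iff nonempty_has_size[symmetric])

lemma big_omega_le_dvd: "d dvd n \<Longrightarrow> n > 0 \<Longrightarrow> big_omega d \<le> big_omega n"
  by (auto simp: big_omega_mult elim!: dvdE)

text \<open>Splitting off a prime lowers the count by one and the number by at least one. The bound
  reconciles the range of summation in \<open>D_fun\<close> with the one ending at
  \<open>big_omega n\<close>.\<close>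

lemma big_omega_le_self: "big_omega n \<le> n"
proof (induction n rule: less_induct)
  case (less n)
  show ?case
  proof (cases "n \<le> 1")
    case True
    then have "n = 0 \<or> n = 1" by auto
    then show ?thesis by (auto simp: big_omega_def)
  next
    case False
    then obtain p where p: "prime p" "p dvd n" using prime_factor_nat[of n] by auto
    then obtain m where m: "n = p * m" by auto
    have "m > 0" using False m by (cases m) auto
    have "p \<ge> 2" using p(1) by (rule prime_ge_2_nat)
    then have "2 * m \<le> n" using m by simp
    then have "m < n" using \<open>m > 0\<close> by linarith
    have "big_omega p = 1" using p(1) by (simp add: big_omega_def prime_factorization_prime)
    then have "big_omega n = 1 + big_omega m"
      using m \<open>m > 0\<close> \<open>p \<ge> 2\<close> by (simp add: big_omega_mult)
    then show ?thesis using less.IH[OF \<open>m < n\<close>] \<open>m < n\<close> by linarith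
  qed
qed

lemma sum_ds_Suc:
  "(\<Sum>i = 1..Suc M. ds g i n) =
     g_pm g n + (\<Sum>d | d dvd n \<and> d > 1. g d * (\<Sum>i = 1..M. ds g i (n div d)))"
proof -
  have "(\<Sum>i = 1..Suc M. ds g i n) = g_pm g n + (\<Sum>i = 1..M. ds g (Suc i) n)"
    by (subst sum.atLeast_Suc_atMost) (simp_all add: sum.shift_bounds_cl_Suc_ivl del: sum.cl_ivl_Suc)
  also have "(\<Sum>i = 1..M. ds g (Suc i) n) =
      (\<Sum>i = 1..M. \<Sum>d | d dvd n \<and> d > 1. g d * ds g i (n div d))"
  proof (rule sum.cong[OF refl])
    fix i assume "i \<in> {1..M}"
    then obtain l where "i = Suc l" by (cases i) auto
    then show "ds g (Suc i) n = (\<Sum>d | d dvd n \<and> d > 1. g d * ds g i (n div d))" by simp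
  qed
  also have "\<dots> = (\<Sum>d | d dvd n \<and> d > 1. g d * (\<Sum>i = 1..M. ds g i (n div d)))"
    by (subst sum.swap) (simp add: sum_distrib_left)
  finally show ?thesis .
qed

text \<open>
  With \<open>h = g - \<epsilon>\<close>, where \<open>\<epsilon>\<close> is the convolution unit, \<open>ds\<^sub>j = h\<^sup>j - h\<^sup>j\<^sup>-\<^sup>1\<close> in the Dirichlet ring,
  so the partial sums telescope to \<open>h\<^sup>M - \<epsilon>\<close>; and \<open>h\<^sup>M\<close> vanishes at \<open>n\<close> once \<open>M > \<Omega>(n)\<close>.
\<close>

lemma sum_ds_eq_neg_unit:
  assumes "n > 0" "M > big_omega n"
  shows "(\<Sum>i = 1..M. ds g i n) = - dirichlet_unit n"
  using assms
proof (induction M arbitrary: n)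
  case (Suc M)
  define D where "D = {d. d dvd n \<and> d > 1}"
  have "finite D" using Suc.prems by (auto simp: D_def)
  have "(\<Sum>d\<in>D. g d * (\<Sum>i = 1..M. ds g i (n div d))) = (\<Sum>d\<in>D. g d * - dirichlet_unit (n div d))"
  proof (intro sum.cong refl arg_cong2[of _ _ _ _ "(*)"])
    fix d assume "d \<in> D"
    then obtain m where m: "n = d * m" "d > 1" by (auto simp: D_def)
    then have "m > 0" using Suc.prems by (cases m) auto
    \<comment> \<open>Dividing by \<open>d > 1\<close> removes at least one prime factor, which pays
      for the shorter partial sum.\<close>
    then have "big_omega m < M"
      using m Suc.prems big_omega_pos[of d] by (simp add: big_omega_mult)
    then show "(\<Sum>i = 1..M. ds g i (n div d)) = - dirichlet_unit (n div d)"
      using Suc.IH[OF \<open>m > 0\<close>] m by simp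
  qed
  also have "\<dots> = (\<Sum>d\<in>D \<inter> {n}. g d * - dirichlet_unit (n div d))"
    by (rule sum.mono_neutral_right)
       (use \<open>finite D\<close> Suc.prems in \<open>auto simp: D_def dirichlet_unit_def dvd_def\<close>)
  also have "\<dots> = (if n = 1 then 0 else - g n)"
    using Suc.prems by (auto simp: D_def dirichlet_unit_def)
  \<comment> \<open>For \<open>n > 1\<close> the terms \<open>g n\<close> cancel; for
    \<open>n = 1\<close> only \<open>g_pm g 1 = -1\<close> remains.\<close>
  finally show ?case
    unfolding sum_ds_Suc D_def by (simp add: g_pm_def dirichlet_unit_def)
qed simp

text \<open>Two consecutive partial sums have already reached the same value, so their difference
  vanishes.\<close>

lemma ds_eq_0:
  assumes "n > 0" "i > Suc (big_omega n)"
  shows "ds g i n = 0"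
proof -
  obtain M where M: "i = Suc M" "M > big_omega n" using assms by (cases i) auto
  have "(\<Sum>i = 1..Suc M. ds g i n) = (\<Sum>i = 1..M. ds g i n)"
    using M(2) assms(1) by (subst (1 2) sum_ds_eq_neg_unit) auto
  then show ?thesis by (simp add: M)
qed

text \<open>Beyond \<open>j = big_omega n\<close> the index \<open>2 * j\<close> exceeds
  \<open>Suc (big_omega n)\<close>, so all further terms vanish. A free bound \<open>N\<close>
  allows one range for all divisors of a number.\<close>

lemma D_fun_eq:
  assumes "n > 0" "big_omega n \<le> N"
  shows "D_fun g n = (\<Sum>j = 1..N. ds g (2 * j) n)"
proof -
  have *: "(\<Sum>j = 1..N. ds g (2 * j) n) = (\<Sum>j = 1..big_omega n. ds g (2 * j) n)"
    if "big_omega n \<le> N" for N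
    by (rule sum.mono_neutral_right) (use that assms in \<open>auto intro!: ds_eq_0\<close>)
  show ?thesis
    unfolding D_fun_def using *[OF assms(2)] *[OF big_omega_le_self] by simp
qed

text \<open>The divisor \<open>1\<close> reproduces the function because \<open>g 1 = 1\<close>, and
  the divisors above \<open>1\<close> give the recursion for the next index.\<close>

lemma conv_ds:
  assumes "g 1 = 1" "n > 0"
  shows "(g \<star> ds g (Suc i)) n = ds g (Suc i) n + ds g (Suc (Suc i)) n"
proof -
  have "{d. d dvd n} = insert 1 {d. d dvd n \<and> d > 1}"
    using assms(2) by (auto dest: dvd_pos_nat intro: ccontr)
  moreover have "finite {d. d dvd n \<and> d > 1}" using assms by simp
  ultimately show ?thesis using assms by (simp add: dirichlet_conv_def)
qed

text \<open>Convolving \<open>g\<close> with the terms of even index yields every index from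
  \<open>2\<close> on; with the first term added back, this is a partial sum of known value.\<close>

lemma conv_unit_plus_D_fun:
  assumes g: "g 1 = 1" and n: "n > 0"
  shows "(g \<star> (\<lambda>m. dirichlet_unit m + D_fun g m)) n = dirichlet_unit n"
proof -
  have pairs: "(\<Sum>j = 1..N. ds g (2 * j) n + ds g (Suc (2 * j)) n) =
      (\<Sum>i = 1..Suc (2 * N). ds g i n) - ds g 1 n" for N
    by (induction N) simp_all
  \<comment> \<open>The range \<open>1..n\<close> serves every divisor of \<open>n\<close>, so the
    sum can be pulled out of the convolution.\<close>
  have "(g \<star> D_fun g) n = (g \<star> (\<lambda>m. \<Sum>j = 1..n. ds g (2 * j) m)) n"
  proof (rule dirichlet_conv_cong)
    fix d assume "d dvd n"
    then have "d > 0" "d \<le> n" using n by (auto simp: dvd_imp_le dvd_pos_nat)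
    then show "D_fun g d = (\<Sum>j = 1..n. ds g (2 * j) d)"
      by (intro D_fun_eq) (auto intro: order_trans[OF big_omega_le_self])
  qed simp
  also have "\<dots> = (\<Sum>j = 1..n. ds g (2 * j) n + ds g (Suc (2 * j)) n)"
    unfolding dirichlet_conv_sum_right
  proof (rule sum.cong[OF refl])
    fix j assume "j \<in> {1..n}"
    then obtain i where "2 * j = Suc i" by (cases "2 * j") auto
    then show "(g \<star> ds g (2 * j)) n = ds g (2 * j) n + ds g (Suc (2 * j)) n"
      using conv_ds[of g, OF g n, of i] by simp
  qed
  also have "\<dots> = (\<Sum>i = 1..Suc (2 * n). ds g i n) - ds g 1 n"
    by (rule pairs)
  also have "(\<Sum>i = 1..Suc (2 * n). ds g i n) = - dirichlet_unit n"
    by (rule sum_ds_eq_neg_unit) (use n big_omega_le_self[of n] in auto)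
  finally have "(g \<star> D_fun g) n = - dirichlet_unit n - g_pm g n" by simp
  then have "(g \<star> (\<lambda>m. dirichlet_unit m + D_fun g m)) n = g n - dirichlet_unit n - g_pm g n"
    using n by (simp add: dirichlet_conv_add_right dirichlet_conv_unit_right)
  \<comment> \<open>\<open>g\<close> and \<open>g_pm g\<close> differ only at \<open>1\<close>, by
    \<open>2\<close>; subtracting the unit leaves \<open>1\<close> there.\<close>
  then show ?thesis using g by (simp add: g_pm_def dirichlet_unit_def)
qed

text \<open>A divisor of \<open>n\<close> has at most \<open>big_omega n\<close> prime factors, so
  this one cutoff is valid for every value of \<open>D_fun g\<close> in the convolution.\<close>

lemma sum_conv_ds:
  assumes "n > 0"
  shows "(\<Sum>j = 1..big_omega n. (f \<star> ds g (2 * j)) n) = (f \<star> D_fun g) n"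
  unfolding dirichlet_conv_sum_right[symmetric]
  by (intro dirichlet_conv_cong refl D_fun_eq[symmetric])
     (auto intro: big_omega_le_dvd dest: dvd_pos_nat)

section \<open>Partitions and Lambert series\<close>

definition bounded_partitions :: "nat \<Rightarrow> nat \<Rightarrow> nat multiset set" where
  "bounded_partitions N n = {M. set_mset M \<subseteq> {1..N} \<and> \<Sum>\<^sub># M = n}"

definition bounded_partition_fps :: "nat \<Rightarrow> complex fps" where
  "bounded_partition_fps N = Abs_fps (\<lambda>n. of_nat (card (bounded_partitions N n)))"

lemma finite_bounded_partitions: "finite (bounded_partitions N n)"
  by (rule finite_subset[OF _ finite_partitions[of "int n"]]) (auto simp: bounded_partitions_def)

lemma partition_part_le: "x \<in># M \<Longrightarrow> x \<le> \<Sum>\<^sub># M" for x :: nat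
  by (auto dest!: multi_member_split)

lemma bounded_partitions_eq:
  assumes "n \<le> N"
  shows "bounded_partitions N n = {M. 0 \<notin># M \<and> int (\<Sum>\<^sub># M) = int n}"
proof -
  have "set_mset M \<subseteq> {1..N} \<longleftrightarrow> 0 \<notin># M" if "\<Sum>\<^sub># M = n" for M
  proof
    assume "0 \<notin># M"
    show "set_mset M \<subseteq> {1..N}"
    proof
      fix x assume "x \<in># M"
      then have "x \<noteq> 0" "x \<le> n"
        using \<open>0 \<notin># M\<close> that partition_part_le by metis+
      then show "x \<in> {1..N}" using assms by simp
    qed
  qed auto
  then show ?thesis unfolding bounded_partitions_def of_nat_eq_iff by blast
qed

text \<open>Either \<open>Suc N\<close> does not occur as a part, or one copy of it can be removed;
  further copies may remain, so the bound stays \<open>Suc N\<close>.\<close>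

lemma card_bounded_partitions_Suc:
  "card (bounded_partitions (Suc N) n) = card (bounded_partitions N n) +
     (if n < Suc N then 0 else card (bounded_partitions (Suc N) (n - Suc N)))"
proof -
  define A where "A = {M \<in> bounded_partitions (Suc N) n. Suc N \<in># M}"
  have split: "bounded_partitions (Suc N) n = bounded_partitions N n \<union> A"
    by (auto simp: bounded_partitions_def A_def subset_iff le_Suc_eq)
  have disj: "bounded_partitions N n \<inter> A = {}"
    by (auto simp: bounded_partitions_def A_def)
  have "finite A" by (simp add: A_def finite_bounded_partitions)
  with split disj have "card (bounded_partitions (Suc N) n) = card (bounded_partitions N n) + card A"
    by (simp add: card_Un_disjoint finite_bounded_partitions)
  moreover have "card A = (if n < Suc N then 0 else card (bounded_partitions (Suc N) (n - Suc N)))"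
  proof (cases "n < Suc N")
    case True
    then have "A = {}" by (auto simp: A_def bounded_partitions_def dest: partition_part_le)
    then show ?thesis using True by simp
  next
    case False
    have "bij_betw (\<lambda>M. M - {#Suc N#}) A (bounded_partitions (Suc N) (n - Suc N))"
    proof (rule bij_betw_byWitness[where f' = "add_mset (Suc N)"])
      show "(\<lambda>M. M - {#Suc N#}) ` A \<subseteq> bounded_partitions (Suc N) (n - Suc N)"
      proof
        fix M assume "M \<in> (\<lambda>M. M - {#Suc N#}) ` A"
        then obtain M' where M': "M' \<in> A" "M = M' - {#Suc N#}" by auto
        then have "add_mset (Suc N) M \<in> A" by (simp add: A_def)
        then show "M \<in> bounded_partitions (Suc N) (n - Suc N)"
          by (auto simp: A_def bounded_partitions_def)
      qed
    qed (use False in \<open>auto simp: A_def bounded_partitions_def\<close>)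
    then show ?thesis using False by (simp add: bij_betw_same_card)
  qed
  ultimately show ?thesis by simp
qed

lemma bounded_partition_fps_Suc:
  "(1 - fps_X ^ Suc N) * bounded_partition_fps (Suc N) = bounded_partition_fps N"
proof (rule fps_ext)
  fix n
  show "fps_nth ((1 - fps_X ^ Suc N) * bounded_partition_fps (Suc N)) n =
        fps_nth (bounded_partition_fps N) n"
    by (simp add: left_diff_distrib fps_X_power_mult_nth bounded_partition_fps_def
          card_bounded_partitions_Suc[of N n] del: power_Suc)
qed

lemma bounded_partition_fps_0: "bounded_partition_fps 0 = 1"
proof -
  have "bounded_partitions 0 n = (if n = 0 then {{#}} else {})" for n
    by (auto simp: bounded_partitions_def)
  then show ?thesis by (auto simp: bounded_partition_fps_def fps_eq_iff)
qed

text \<open>The last factor lowers the bound on the parts by one, until only the empty partition is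
  left.\<close>

lemma prod_mult_bounded_partition_fps: "(\<Prod>j<N. 1 - fps_X ^ (j + 1)) * bounded_partition_fps N = 1"
proof (induction N)
  case (Suc N)
  then show ?case
    using bounded_partition_fps_Suc[of N] by (simp add: mult.assoc)
qed (simp add: bounded_partition_fps_0)

definition partition_fps :: "complex fps" where
  "partition_fps = Abs_fps (\<lambda>n. of_nat (partition_count (int n)))"

text \<open>The coefficient at \<open>n\<close> involves only coefficients up to \<open>n\<close>,
  where both series agree with their truncations. The product over \<open>j \<le> n\<close> has
  \<open>Suc n\<close> factors, hence the bound \<open>Suc n\<close> on the parts.\<close>

lemma q_poch_mult_partition_fps: "q_poch * partition_fps = 1"
proof (rule fps_ext)
  fix n
  have "fps_nth (q_poch * partition_fps) n =
        fps_nth ((\<Prod>j\<le>n. 1 - fps_X ^ (j + 1)) * bounded_partition_fps (Suc n)) n"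
    unfolding fps_mult_nth
    by (intro sum.cong refl arg_cong2[of _ _ _ _ "(*)"] q_poch_nth)
       (simp_all add: partition_fps_def bounded_partition_fps_def partition_count_def
          bounded_partitions_eq)
  then show "fps_nth (q_poch * partition_fps) n = fps_nth 1 n"
    using prod_mult_bounded_partition_fps[of "Suc n"] by (simp only: lessThan_Suc_atMost)
qed

lemma p_shift_eq: "p_shift k n = (if n < k then 0 else fps_nth partition_fps (n - k))"
proof (cases "n < k")
  case True
  then have "{M :: nat multiset. 0 \<notin># M \<and> int (\<Sum>\<^sub># M) = int n - int k} = {}"
    by (auto simp del: of_nat_sum_mset)
  then show ?thesis using True by (simp only: p_shift_def partition_count_def) simp
qed (simp add: p_shift_def partition_fps_def of_nat_diff)

text \<open>The column \<open>p_shift k\<close> has generating function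
  \<open>fps_X ^ k * partition_fps\<close>, which \<open>q_poch\<close> turns into
  \<open>fps_X ^ k\<close>.\<close>

lemma sum_q_poch_p_shift:
  assumes "k \<ge> 1"
  shows "(\<Sum>m = 1..n. fps_nth q_poch (n - m) * p_shift k m) = (if n = k then 1 else 0)"
proof -
  have "(\<Sum>m = 1..n. fps_nth q_poch (n - m) * p_shift k m) =
        (\<Sum>m = 0..n. p_shift k m * fps_nth q_poch (n - m))"
    using assms by (intro sum.mono_neutral_cong_left) (auto simp: p_shift_eq not_less_eq_eq)
  also have "\<dots> = fps_nth ((fps_X ^ k * partition_fps) * q_poch) n"
    by (simp add: fps_mult_nth[of "fps_X ^ k * partition_fps"] fps_X_power_mult_nth p_shift_eq)
  also have "(fps_X ^ k * partition_fps) * q_poch = fps_X ^ k"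
    using q_poch_mult_partition_fps by (simp add: mult_ac)
  finally show ?thesis by simp
qed

section \<open>Lambert series\<close>

lemma lambert_fps:
  assumes "k \<ge> 1"
  shows "fps_X ^ k / (1 - fps_X ^ k :: complex fps) =
         Abs_fps (\<lambda>m. if m > 0 \<and> k dvd m then 1 else 0)" (is "_ = ?F")
proof -
  \<comment> \<open>Coefficients at \<open>m\<close> and \<open>m - k\<close> cancel except at
    \<open>m = k\<close>, since the constant term of the series is \<open>0\<close>.\<close>
  have "?F * (1 - fps_X ^ k) = fps_X ^ k"
  proof (rule fps_ext)
    fix m
    show "fps_nth (?F * (1 - fps_X ^ k)) m = fps_nth (fps_X ^ k) m"
      using assms
      by (auto simp: right_diff_distrib fps_X_power_mult_right_nth dvd_minus_self dest: dvd_imp_le)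
  qed
  moreover have "(1 - fps_X ^ k :: complex fps) \<noteq> 0"
  proof -
    have "fps_nth (1 - fps_X ^ k :: complex fps) 0 = 1" using assms by simp
    then show ?thesis by (metis fps_zero_nth zero_neq_one)
  qed
  ultimately show ?thesis by (metis nonzero_mult_div_cancel_right)
qed

lemma s_coeff_eq_sum:
  assumes "k \<ge> 1"
  shows "s_coeff n k = (\<Sum>m = 1..n. fps_nth q_poch (n - m) * (if k dvd m then 1 else 0))"
proof -
  have "s_coeff n k = (\<Sum>m = 0..n. (if m > 0 \<and> k dvd m then 1 else 0) * fps_nth q_poch (n - m))"
    unfolding s_coeff_def lambert_fps[OF assms] mult.commute[of q_poch] by (simp add: fps_mult_nth)
  also have "\<dots> = (\<Sum>m = 1..n. fps_nth q_poch (n - m) * (if k dvd m then 1 else 0))"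
    by (intro sum.mono_neutral_cong_right) (auto simp: not_less_eq_eq)
  finally show ?thesis .
qed

section \<open>The inverse matrix\<close>

text \<open>\<open>k * j\<close> divides \<open>m\<close> exactly when \<open>k\<close> divides
  \<open>m\<close> and \<open>j\<close> divides \<open>m div k\<close>; collecting the
  \<open>g j\<close> gives a divisor sum. This is the factorization of the matrix.\<close>

lemma s_tilde_eq_sum:
  assumes k: "k \<ge> 1"
  shows "s_tilde g n k = (\<Sum>m = 1..n. fps_nth q_poch (n - m) *
           (if k dvd m then (g \<star> (\<lambda>_. 1)) (m div k) else 0))"
proof -
  have "s_tilde g n k =
      (\<Sum>j = 1..n. \<Sum>m = 1..n. fps_nth q_poch (n - m) * (if k * j dvd m then g j else 0))"
    unfolding s_tilde_def
    by (intro sum.cong refl, subst s_coeff_eq_sum)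
       (use k in \<open>auto simp: sum_distrib_right intro!: sum.cong\<close>)
  also have "\<dots> = (\<Sum>m = 1..n. fps_nth q_poch (n - m) *
                   (\<Sum>j = 1..n. if k * j dvd m then g j else 0))"
    by (subst sum.swap) (simp add: sum_distrib_left)
  also have "\<dots> = (\<Sum>m = 1..n. fps_nth q_poch (n - m) *
           (if k dvd m then (g \<star> (\<lambda>_. 1)) (m div k) else 0))"
  proof (intro sum.cong refl arg_cong2[of _ _ _ _ "(*)"])
    fix m assume m: "m \<in> {1..n}"
    show "(\<Sum>j = 1..n. if k * j dvd m then g j else 0) =
          (if k dvd m then (g \<star> (\<lambda>_. 1)) (m div k) else 0)"
    proof (cases "k dvd m")
      case True
      then obtain l where l: "m = k * l" by auto
      have "l > 0" using l m by (cases l) auto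
      have "l \<le> m" using l k by simp
      have "(\<Sum>j = 1..n. if k * j dvd m then g j else 0) = (\<Sum>j | j dvd l. g j)"
      proof (rule sum.mono_neutral_cong_right)
        show "{j. j dvd l} \<subseteq> {1..n}"
        proof
          fix j assume "j \<in> {j. j dvd l}"
          then have "j > 0" "j \<le> l" using \<open>l > 0\<close> by (auto dest: dvd_imp_le dvd_pos_nat)
          then show "j \<in> {1..n}" using \<open>l \<le> m\<close> m by simp
        qed
      qed (use l k in auto)
      then show ?thesis using l k by (simp add: dirichlet_conv_one_right)
    next
      case False
      then have "\<not> k * j dvd m" for j by (meson dvd_mult_left)
      then show ?thesis using False by simp
    qed
  qed
  finally show ?thesis .
qed

text \<open>On a column \<open>f\<close>, the divisibility factor of the matrix acts as convolution
  with \<open>g \<star> (\<lambda>_. 1)\<close>.\<close>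

lemma sum_s_tilde_mult:
  "(\<Sum>j = 1..n. s_tilde g n j * f j) =
   (\<Sum>m = 1..n. fps_nth q_poch (n - m) * (f \<star> (g \<star> (\<lambda>_. 1))) m)"
proof -
  have "(\<Sum>j = 1..n. s_tilde g n j * f j) = (\<Sum>j = 1..n. \<Sum>m = 1..n. fps_nth q_poch (n - m) *
           (if j dvd m then f j * (g \<star> (\<lambda>_. 1)) (m div j) else 0))"
    by (intro sum.cong refl, subst s_tilde_eq_sum)
       (auto simp: sum_distrib_right intro!: sum.cong)
  also have "\<dots> = (\<Sum>m = 1..n. fps_nth q_poch (n - m) *
                   (\<Sum>j = 1..n. if j dvd m then f j * (g \<star> (\<lambda>_. 1)) (m div j) else 0))"
    by (subst sum.swap) (simp add: sum_distrib_left)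
  also have "\<dots> = (\<Sum>m = 1..n. fps_nth q_poch (n - m) * (f \<star> (g \<star> (\<lambda>_. 1))) m)"
  proof (intro sum.cong refl arg_cong2[of _ _ _ _ "(*)"])
    fix m assume m: "m \<in> {1..n}"
    have "{d. d dvd m} \<subseteq> {1..n}"
    proof
      fix d assume "d \<in> {d. d dvd m}"
      then have "d > 0" "d \<le> m" using m by (auto dest: dvd_imp_le dvd_pos_nat)
      then show "d \<in> {1..n}" using m by simp
    qed
    then show "(\<Sum>j = 1..n. if j dvd m then f j * (g \<star> (\<lambda>_. 1)) (m div j) else 0) =
          (f \<star> (g \<star> (\<lambda>_. 1))) m"
      unfolding dirichlet_conv_def[of f] by (intro sum.mono_neutral_cong_right) auto
  qed
  finally show ?thesis .
qed

text \<open>In the proposed column, \<open>g\<close> cancels \<open>e\<close> and the constant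
  \<open>1\<close> cancels \<open>mu\<close>. What remains is \<open>p_shift k\<close>, which the
  \<open>q_poch\<close> factor sends to a unit vector.\<close>

lemma s_inv_eq:
  assumes g: "g 1 = 1" and nk: "n \<ge> 1" "k \<ge> 1"
  shows "s_inv g n k = (p_shift k \<star> (\<lambda>m. dirichlet_unit m + D_fun g m) \<star> mu) n"
proof -
  define e where "e = (\<lambda>m. dirichlet_unit m + D_fun g m)"
  have inv: "is_lt_inverse (s_tilde g) (s_inv g)" using g by (rule is_lt_inverse_s_inv)
  have conv: "(p_shift k \<star> e \<star> mu \<star> (g \<star> (\<lambda>_. 1))) m = p_shift k m" if "m > 0" for k m
  proof -
    have "p_shift k \<star> e \<star> mu \<star> (g \<star> (\<lambda>_. 1)) = p_shift k \<star> ((g \<star> e) \<star> (mu \<star> (\<lambda>_. 1)))"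
      by (metis dirichlet_conv_assoc dirichlet_conv_commute)
    then have "(p_shift k \<star> e \<star> mu \<star> (g \<star> (\<lambda>_. 1))) m =
        (p_shift k \<star> ((g \<star> e) \<star> (mu \<star> (\<lambda>_. 1)))) m" by simp
    also have "\<dots> = (p_shift k \<star> dirichlet_unit) m"
    proof (rule dirichlet_conv_cong)
      fix d assume "d dvd m" "m > 0"
      then have "d > 0" by (auto dest: dvd_pos_nat)
      have "((g \<star> e) \<star> (mu \<star> (\<lambda>_. 1))) d = (dirichlet_unit \<star> dirichlet_unit) d"
        by (rule dirichlet_conv_cong)
           (auto simp: e_def conv_unit_plus_D_fun[of g, OF g] mu_conv_one dest: dvd_pos_nat)
      then show "((g \<star> e) \<star> (mu \<star> (\<lambda>_. 1))) d = dirichlet_unit d"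
        using \<open>d > 0\<close> by (simp add: dirichlet_conv_unit_right)
    qed simp
    finally show ?thesis using that by (simp add: dirichlet_conv_unit_right)
  qed
  have right: "(\<Sum>j = 1..n. s_tilde g n j * (p_shift k \<star> e \<star> mu) j) = (if n = k then 1 else 0)"
    if "n \<ge> 1" "k \<ge> 1" for n k
    unfolding sum_s_tilde_mult sum_q_poch_p_shift[OF that(2), symmetric]
    by (intro sum.cong refl) (simp add: conv)
  \<comment> \<open>The left inverse \<open>s_inv g\<close> must coincide with the right inverse
    just found.\<close>
  have "s_inv g n k = (\<lambda>j k. (p_shift k \<star> e \<star> mu) j) n k"
    by (rule lt_inverses_eq[OF lower_triangular_s_tilde[of g] _ right])
       (use inv nk in \<open>auto simp: is_lt_inverse_def\<close>)
  then show ?thesis by (simp add: e_def)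
qed

theorem theorem4p2:
  fixes g :: "nat \<Rightarrow> complex"
  assumes "g 1 = 1"
  shows "\<forall>n\<ge>1. \<forall>k\<ge>1.
    ((\<Sum>d | d dvd n. s_inv g d k)
        = p_shift k n + (\<Sum>j = 1..big_omega n. (p_shift k \<star> ds g (2 * j)) n)
     \<and> p_shift k n + (\<Sum>j = 1..big_omega n. (p_shift k \<star> ds g (2 * j)) n)
        = p_shift k n + (p_shift k \<star> D_fun g) n)
    \<and> (s_inv g n k
        = (p_shift k \<star> mu) n + (\<Sum>j = 1..big_omega n. (p_shift k \<star> ds g (2 * j) \<star> mu) n)
     \<and> (p_shift k \<star> mu) n + (\<Sum>j = 1..big_omega n. (p_shift k \<star> ds g (2 * j) \<star> mu) n)
        = (p_shift k \<star> mu) n + (p_shift k \<star> D_fun g \<star> mu) n)"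
proof (intro allI impI)
  fix n k :: nat
  assume n: "n \<ge> 1" and k: "k \<ge> 1"
  define p where "p = p_shift k"
  define e where "e = (\<lambda>m. dirichlet_unit m + D_fun g m)"
  \<comment> \<open>With \<open>mu\<close> moved inward, \<open>f\<close> is the last factor, as
    \<open>conv_e\<close> and \<open>sum_conv_ds\<close> require.\<close>
  have swap_mu: "p \<star> f \<star> mu = p \<star> mu \<star> f" for f
    by (metis dirichlet_conv_assoc dirichlet_conv_commute)
  have conv_e: "(f \<star> e) n = f n + (f \<star> D_fun g) n" for f
    using n by (simp add: e_def dirichlet_conv_add_right dirichlet_conv_unit_right)
  have s_inv: "s_inv g m k = (p \<star> e \<star> mu) m" if "m > 0" for m
    using s_inv_eq[of g, OF assms, of m k] that k by (simp add: p_def e_def)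
  \<comment> \<open>Summing over divisors is convolution with \<open>1\<close>, which cancels the
    trailing \<open>mu\<close>.\<close>
  have "(\<Sum>d | d dvd n. s_inv g d k) = ((p \<star> e \<star> mu) \<star> (\<lambda>_. 1)) n"
    unfolding dirichlet_conv_one_right
    by (intro sum.cong refl s_inv) (use n in \<open>auto dest: dvd_pos_nat\<close>)
  also have "\<dots> = ((p \<star> e) \<star> dirichlet_unit) n"
    unfolding dirichlet_conv_assoc[of "p \<star> e"]
    by (rule dirichlet_conv_cong) (auto simp: mu_conv_one dest: dvd_pos_nat)
  also have "\<dots> = p n + (p \<star> D_fun g) n"
    using n by (simp add: dirichlet_conv_unit_right conv_e)
  finally have 1: "(\<Sum>d | d dvd n. s_inv g d k) = p n + (p \<star> D_fun g) n" .
  have 2: "s_inv g n k = (p \<star> mu) n + (p \<star> D_fun g \<star> mu) n"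
    using n by (simp add: s_inv swap_mu conv_e)
  have 3: "(\<Sum>j = 1..big_omega n. (p \<star> ds g (2 * j)) n) = (p \<star> D_fun g) n"
    "(\<Sum>j = 1..big_omega n. (p \<star> ds g (2 * j) \<star> mu) n) = (p \<star> D_fun g \<star> mu) n"
    unfolding swap_mu by (rule sum_conv_ds; use n in simp)+
  show "((\<Sum>d | d dvd n. s_inv g d k)
        = p_shift k n + (\<Sum>j = 1..big_omega n. (p_shift k \<star> ds g (2 * j)) n)
     \<and> p_shift k n + (\<Sum>j = 1..big_omega n. (p_shift k \<star> ds g (2 * j)) n)
        = p_shift k n + (p_shift k \<star> D_fun g) n)
    \<and> (s_inv g n k
        = (p_shift k \<star> mu) n + (\<Sum>j = 1..big_omega n. (p_shift k \<star> ds g (2 * j) \<star> mu) n)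
     \<and> (p_shift k \<star> mu) n + (\<Sum>j = 1..big_omega n. (p_shift k \<star> ds g (2 * j) \<star> mu) n)
        = (p_shift k \<star> mu) n + (p_shift k \<star> D_fun g \<star> mu) n)"
    unfolding p_def[symmetric] 3 using 1 2 by simp
qed

end
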